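(* Let $G$ be a connected interval graph. Then $\rho(G)=0$ if $G$ is a caterpillar, and $\rho(G)=1$ otherwise.
   Context: An interval graph is a graph whose vertices can be assigned real intervals so that two distinct vertices are adjacent if and only if their intervals intersect. A caterpillar is a tree in which every vertex is within distance $1$ of some fixed path. Patrol game with radius of capture $\rho\ge 0$ on a connected graph $G$: there is one cop and one robber. Before the game the cop fixes a walk in $G$ (his patrol: a sequence of vertices in which consecutive vertices are equal or adjacent), and the robber knows the entire patrol in advance, while the cop has no information about the robber. The cop starts at the first vertex of his patrol, then the robber chooses a starting vertex; afterwards the players alternate moves (cop first), the cop following his patrol and the robber moving to an adjacent vertex or staying put. The cop wins if at some moment the distance between the cop and the robber is at most $\rho$; otherwise the robber wins. $\rho(G)$ is the minimum $\rho\ge0$ for which the cop has a patrol capturing the robber regardless of the robber's play. *)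

theory Defs
  imports "HOL-Analysis.Analysis" "Graph_Theory.Graph_Theory"
begin

text \<open>
  A finite simple graph is a \<^locale>\<open>pair_graph\<close>: a finite, symmetric, loop-free arc relation.
  Distances are numbers of edges, that is, shortest-path weights for unit arc costs.
\<close>

definition graph_dist :: "'a pair_pre_digraph \<Rightarrow> 'a \<Rightarrow> 'a \<Rightarrow> ereal" where
  "graph_dist G u v = wf_digraph.\<mu> (with_proj G) (\<lambda>_. 1) u v"

text \<open>The intervals may be open, closed, half-open or unbounded.\<close>

definition interval_graph :: "'a pair_pre_digraph \<Rightarrow> bool" where
  "interval_graph G \<longleftrightarrow>
     (\<exists>I :: 'a \<Rightarrow> real set.
        (\<forall>v\<in>pverts G. is_interval (I v) \<and> I v \<noteq> {}) \<and>
        (\<forall>u\<in>pverts G. \<forall>v\<in>pverts G. u \<noteq> v \<longrightarrow>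
           ((u, v) \<in> parcs G \<longleftrightarrow> I u \<inter> I v \<noteq> {})))"

text \<open>
  The library's \<^const>\<open>tree\<close> is not usable here: it excludes directed cycles, and every edge of a
  symmetric digraph gives the directed cycle \<open>u, v, u\<close>. A cycle of a simple graph has at least
  three vertices.
\<close>

definition undirected_cycle :: "'a pair_pre_digraph \<Rightarrow> 'a list \<Rightarrow> bool" where
  "undirected_cycle G c \<longleftrightarrow>
     vpath c (with_proj G) \<and> 3 \<le> length c \<and> (last c, hd c) \<in> parcs G"

definition undirected_tree :: "'a pair_pre_digraph \<Rightarrow> bool" where
  "undirected_tree G \<longleftrightarrow>
     Digraph_Component.connected (with_proj G) \<and> (\<nexists>c. undirected_cycle G c)"

definition caterpillar :: "'a pair_pre_digraph \<Rightarrow> bool" where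
  "caterpillar G \<longleftrightarrow>
     undirected_tree G \<and>
     (\<exists>p. vpath p (with_proj G) \<and>
        (\<forall>v\<in>pverts G. \<exists>u\<in>set p. graph_dist G v u \<le> 1))"

text \<open>
  Both the cop's patrol and the robber's play are infinite walks that may pause at a vertex.
  On a finite graph infinite patrols are no stronger than finite ones.
\<close>

definition lazy_walk :: "'a pair_pre_digraph \<Rightarrow> (nat \<Rightarrow> 'a) \<Rightarrow> bool" where
  "lazy_walk G w \<longleftrightarrow>
     (\<forall>i. w i \<in> pverts G \<and> (w (Suc i) = w i \<or> (w i, w (Suc i)) \<in> parcs G))"

text \<open>
  The positions (cop, robber) occur in the order
  \<open>(p 0, r 0), (p 1, r 0), (p 1, r 1), (p 2, r 1), \<dots>\<close>.
  Since the patrol is fixed and known to the robber, his adaptive strategies amount to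
  sequences \<open>r\<close> chosen after \<open>p\<close>.
\<close>

definition cop_wins :: "'a pair_pre_digraph \<Rightarrow> nat \<Rightarrow> (nat \<Rightarrow> 'a) \<Rightarrow> (nat \<Rightarrow> 'a) \<Rightarrow> bool" where
  "cop_wins G k p r \<longleftrightarrow>
     (\<exists>i. graph_dist G (p i) (r i) \<le> ereal (real k) \<or>
          graph_dist G (p (Suc i)) (r i) \<le> ereal (real k))"

definition winning_patrol :: "'a pair_pre_digraph \<Rightarrow> nat \<Rightarrow> (nat \<Rightarrow> 'a) \<Rightarrow> bool" where
  "winning_patrol G k p \<longleftrightarrow> lazy_walk G p \<and> (\<forall>r. lazy_walk G r \<longrightarrow> cop_wins G k p r)"

text \<open>
  As distances are integers, it suffices to minimise over integral radii. On a finite connected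
  graph the diameter is a feasible radius, so the minimum exists.
\<close>

definition patrol_radius :: "'a pair_pre_digraph \<Rightarrow> nat" where
  "patrol_radius G = (LEAST k. \<exists>p. winning_patrol G k p)"

end

theory Submission
  imports Defs
begin

text \<open>
  For radius 1 the cop walks from the vertex whose interval ends first to the one whose interval
  ends last: an uncaught robber always sits strictly to the right of the cop's interval, since
  passing from right to left requires an interval that meets the cop's. The same walk is a
  spine, so an interval graph that is not a caterpillar has a cycle and therefore a triangle,
  on which the robber evades every cop of radius 0. In a triangle-free interval graph the cop
  instead moves along cut vertices \<open>v\<close> separating the intervals that reach beyond \<open>v\<close> from the
  others, and at each one he visits and leaves the neighbours ending by \<open>v\<close>, one at a time.
\<close>

section \<open>Patrols as sets of possible robber positions\<close>

text \<open>\<open>S\<close> collects the possible positions of the robber after his move, when the cop is at \<open>x\<close>.\<close>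

definition trap :: "'a pair_pre_digraph \<Rightarrow> nat \<Rightarrow> 'a \<Rightarrow> 'a set \<Rightarrow> bool" where
  "trap G k x S \<longleftrightarrow>
     (\<exists>p. lazy_walk G p \<and> p 0 = x \<and> (\<forall>r. lazy_walk G r \<and> r 0 \<in> S \<longrightarrow> cop_wins G k p r))"

lemma trap_empty: "x \<in> pverts G \<Longrightarrow> trap G k x {}"
  unfolding trap_def by (rule exI[of _ "\<lambda>_. x"]) (auto simp: lazy_walk_def)

lemma trap_mono: "trap G k x T \<Longrightarrow> S \<subseteq> T \<Longrightarrow> trap G k x S"
  unfolding trap_def by blast

text \<open>The patrol for \<open>T\<close> is prefixed by \<open>x\<close>. In the first round the
  cop steps to \<open>y\<close> while the robber is on \<open>r\<close>, then the robber steps to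
  \<open>r'\<close>. If either position is within range of \<open>y\<close> the cop has won, so
  \<open>T\<close> need only contain the \<open>r'\<close> of robbers missed both times.\<close>

lemma trap_step:
  assumes "trap G k y T" and x: "x \<in> pverts G" and xy: "y = x \<or> (x, y) \<in> parcs G"
    and next_pos: "\<And>r r'. \<lbrakk>r \<in> S; r \<in> pverts G; r' \<in> pverts G; r' = r \<or> (r, r') \<in> parcs G;
      \<not> graph_dist G y r \<le> ereal (real k); \<not> graph_dist G y r' \<le> ereal (real k)\<rbrakk> \<Longrightarrow> r' \<in> T"
  shows "trap G k x S"
proof -
  obtain p where p: "lazy_walk G p" "p 0 = y"
    and win: "\<And>r. lazy_walk G r \<Longrightarrow> r 0 \<in> T \<Longrightarrow> cop_wins G k p r"
    using assms(1) by (auto simp: trap_def)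
  let ?q = "case_nat x p"
  have "lazy_walk G ?q"
    using p x xy by (auto simp: lazy_walk_def split: nat.splits)
  moreover have "cop_wins G k ?q r" if r: "lazy_walk G r" "r 0 \<in> S" for r
  proof (rule ccontr)
    assume "\<not> cop_wins G k ?q r"
    then have far: "\<not> graph_dist G (?q i) (r i) \<le> ereal (real k)"
      "\<not> graph_dist G (?q (Suc i)) (r i) \<le> ereal (real k)" for i
      by (auto simp: cop_wins_def)
    have "r 1 \<in> T"
      using next_pos[of "r 0" "r 1"] r far(2)[of 0] far(1)[of 1] p(2)
      by (auto simp: lazy_walk_def)
    moreover have "lazy_walk G (\<lambda>i. r (Suc i))"
      using r by (auto simp: lazy_walk_def)
    ultimately have "cop_wins G k p (\<lambda>i. r (Suc i))"
      using win by simp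
    then show False
      using far(1)[of "Suc _"] far(2)[of "Suc _"] by (auto simp: cop_wins_def)
  qed
  ultimately show ?thesis
    unfolding trap_def by (intro exI[of _ ?q]) auto
qed

lemma trap_imp_winning_patrol:
  assumes "trap G k x {r \<in> pverts G. \<not> graph_dist G x r \<le> ereal (real k)}"
  shows "\<exists>p. winning_patrol G k p"
proof -
  obtain p where p: "lazy_walk G p" "p 0 = x"
    and win: "\<And>r. lazy_walk G r \<Longrightarrow> r 0 \<in> pverts G \<Longrightarrow>
      \<not> graph_dist G x (r 0) \<le> ereal (real k) \<Longrightarrow> cop_wins G k p r"
    using assms by (auto simp: trap_def)
  have "cop_wins G k p r" if "lazy_walk G r" for r
  proof (cases "graph_dist G x (r 0) \<le> ereal (real k)")
    case True
    then show ?thesis using p(2) unfolding cop_wins_def by blast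
  next
    case False
    then show ?thesis using win that by (auto simp: lazy_walk_def)
  qed
  with p show ?thesis by (auto simp: winning_patrol_def)
qed

text \<open>Meant for \<open>ends_by\<close>, which is total and transitive but not antisymmetric,
  since right ends may tie; it supplies a first and a last vertex.\<close>

lemma finite_total_preorder_least:
  assumes "finite A" "A \<noteq> {}"
    and "\<And>x y. x \<in> A \<Longrightarrow> y \<in> A \<Longrightarrow> R x y \<or> R y x"
    and "\<And>x y z. R x y \<Longrightarrow> R y z \<Longrightarrow> R x z"
  shows "\<exists>x\<in>A. \<forall>y\<in>A. R x y"
  using assms(1-3)
proof (induction A rule: finite_ne_induct)
  case (insert a A)
  then obtain x where x: "x \<in> A" "\<forall>y\<in>A. R x y" by blast
  have refl: "R a a" using insert.prems[of a a] by blast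
  show ?case
  proof (cases "R x a")
    case False
    then have "R a x" using insert.prems[of x a] x(1) by blast
    then have "\<forall>y\<in>A. R a y" using x(2) assms(4)[of a x] by blast
    with refl show ?thesis by blast
  qed (use x in blast)
qed auto

section \<open>Distances zero and one, and evasion on a triangle\<close>

context pair_graph
begin

lemma arc_sym: "(u, v) \<in> parcs G \<Longrightarrow> (v, u) \<in> parcs G"
  using pair_sym_arcs unfolding symmetric_def with_proj_simps by (rule symD)

lemma arc_neq: "(u, v) \<in> parcs G \<Longrightarrow> u \<noteq> v"
  using pair_no_loops by fastforce

lemma graph_dist_le_0_iff:
  assumes "u \<in> pverts G"
  shows "graph_dist G u v \<le> 0 \<longleftrightarrow> u = v"
proof
  assume le: "graph_dist G u v \<le> 0"
  show "u = v"
  proof (rule ccontr)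
    assume "u \<noteq> v"
    have "ereal 1 \<le> awalk_cost (\<lambda>_. 1) p" if "awalk u p v" for p
      using that \<open>u \<noteq> v\<close> by (cases p) (auto simp: awalk_cost_def sum_list_triv awalk_def)
    then have "ereal 1 \<le> graph_dist G u v"
      unfolding graph_dist_def \<mu>_def by (intro INF_greatest) auto
    with le show False using order_trans by fastforce
  qed
next
  assume "u = v"
  then have "awalk u [] v" using assms by (simp add: awalk_Nil_iff)
  from min_cost_le_walk_cost[OF this, of "\<lambda>_. 1"]
  show "graph_dist G u v \<le> 0"
    by (simp add: graph_dist_def zero_ereal_def)
qed

lemma graph_dist_self_le: "u \<in> pverts G \<Longrightarrow> graph_dist G u u \<le> 1"
  by (rule order_trans[of _ 0]) (simp_all add: graph_dist_le_0_iff)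

lemma graph_dist_arc_le: "(u, v) \<in> parcs G \<Longrightarrow> graph_dist G u v \<le> 1"
  using min_cost_le_walk_cost[of u "[(u, v)]" v "\<lambda>_. 1"]
  by (auto simp: graph_dist_def awalk_Cons_iff awalk_Nil_iff in_arcsD2 one_ereal_def)

text \<open>
  On a triangle some vertex avoids both the current and the next position of the cop, and all
  vertices of the triangle are within one step of each other.
\<close>

lemma no_winning_patrol_of_triangle:
  assumes xy: "(x, y) \<in> parcs G" and yz: "(y, z) \<in> parcs G" and zx: "(z, x) \<in> parcs G"
  shows "\<not> winning_patrol G 0 p"
proof
  assume win: "winning_patrol G 0 p"
  have "\<exists>c\<in>{x, y, z}. c \<noteq> p i \<and> c \<noteq> p (Suc i)" for i
    using arc_neq[OF xy] arc_neq[OF yz] arc_neq[OF zx] by auto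
  then obtain r where r: "\<And>i. r i \<in> {x, y, z}" "\<And>i. r i \<noteq> p i" "\<And>i. r i \<noteq> p (Suc i)"
    by metis
  have "r i \<in> pverts G \<and> (r (Suc i) = r i \<or> (r i, r (Suc i)) \<in> parcs G)" for i
    using r(1)[of i] r(1)[of "Suc i"] arc_sym xy yz zx in_arcsD1 by auto
  then have "cop_wins G 0 p r"
    using win by (auto simp: winning_patrol_def lazy_walk_def)
  moreover have "p i \<in> pverts G" for i
    using win by (auto simp: winning_patrol_def lazy_walk_def)
  ultimately show False
    using r graph_dist_le_0_iff by (auto simp: cop_wins_def zero_ereal_def[symmetric]) metis+
qed

lemma caterpillar_triangle_free:
  assumes "caterpillar G" "(x, y) \<in> parcs G" "(y, z) \<in> parcs G" "(z, x) \<in> parcs G"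
  shows False
proof -
  have "undirected_cycle G [x, y, z]"
    using assms(2-4) arc_neq in_arcsD1
    by (auto simp: undirected_cycle_def vpath_def vwalk_def)
  with assms(1) show False
    by (auto simp: caterpillar_def undirected_tree_def)
qed

end

section \<open>Comparing intervals by position and by right end\<close>

locale connected_interval_graph = pair_graph G for G :: "'a pair_pre_digraph" +
  fixes I :: "'a \<Rightarrow> real set"
  assumes conn: "Digraph_Component.connected (with_proj G)"
    and interval: "v \<in> pverts G \<Longrightarrow> is_interval (I v)"
    and nonempty: "v \<in> pverts G \<Longrightarrow> I v \<noteq> {}"
    and arc_iff: "\<lbrakk>u \<in> pverts G; v \<in> pverts G; u \<noteq> v\<rbrakk> \<Longrightarrow> (u, v) \<in> parcs G \<longleftrightarrow> I u \<inter> I v \<noteq> {}"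
begin

definition before :: "'a \<Rightarrow> 'a \<Rightarrow> bool" where
  "before u v \<longleftrightarrow> (\<forall>a\<in>I u. \<forall>b\<in>I v. a < b)"

text \<open>Compares right ends without suprema, as the intervals may be open or unbounded.\<close>

definition ends_by :: "'a \<Rightarrow> 'a \<Rightarrow> bool" where
  "ends_by u v \<longleftrightarrow> (\<forall>a\<in>I u. \<exists>b\<in>I v. a \<le> b)"

lemma verts_nonempty: "pverts G \<noteq> {}"
  using conn by (auto simp: connected_def strongly_connected_def)

lemma all_reachable: "u \<in> pverts G \<Longrightarrow> v \<in> pverts G \<Longrightarrow> u \<rightarrow>\<^sup>*\<^bsub>with_proj G\<^esub> v"
  using conn reachable_mk_symmetric_eq[OF pair_sym_arcs]
  by (auto simp: connected_def strongly_connected_def)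

lemma in_between:
  "\<lbrakk>v \<in> pverts G; a \<in> I v; b \<in> I v; a \<le> x; x \<le> b\<rbrakk> \<Longrightarrow> x \<in> I v"
  using interval by (meson is_interval_1)

lemma arc_meet:
  assumes "(u, v) \<in> parcs G"
  obtains a where "a \<in> I u" "a \<in> I v"
  using arc_iff[OF in_arcsD1[OF assms] in_arcsD2[OF assms] arc_neq[OF assms]] assms by blast

lemma meet_cases:
  assumes "u \<in> pverts G" "v \<in> pverts G"
  obtains "u = v" | "(u, v) \<in> parcs G" | "before u v" | "before v u"
proof (cases "I u \<inter> I v = {}")
  case True
  have "before u v \<or> before v u"
  proof (rule ccontr)
    assume "\<not> ?thesis"
    then obtain a b a' b' where "a \<in> I u" "b \<in> I v" "b \<le> a" "a' \<in> I u" "b' \<in> I v" "a' \<le> b'"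
      unfolding before_def by (meson not_less)
    \<comment> \<open>Either \<open>b\<close> lies between \<open>a'\<close> and \<open>a\<close>,
      or \<open>a'\<close> lies between \<open>b\<close> and \<open>b'\<close>; convexity does the
      rest.\<close>
    then have "b \<in> I u \<or> a' \<in> I v"
      using in_between[OF assms(1), of a' a b] in_between[OF assms(2), of b b' a'] by linarith
    then show False using True \<open>b \<in> I v\<close> \<open>a' \<in> I u\<close> by blast
  qed
  then show ?thesis using that by blast
next
  case False
  then show ?thesis using that assms arc_iff by blast
qed

lemma before_imp_not_ends_by: "\<lbrakk>before u v; v \<in> pverts G\<rbrakk> \<Longrightarrow> \<not> ends_by v u"
  unfolding before_def ends_by_def using nonempty by (metis all_not_in_conv not_less)

lemma ends_by_total: "ends_by u v \<or> ends_by v u"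
  unfolding ends_by_def by (meson linear)

lemma ends_by_refl: "ends_by u u"
  unfolding ends_by_def by blast

lemma ends_by_trans: "ends_by u v \<Longrightarrow> ends_by v w \<Longrightarrow> ends_by u w"
  unfolding ends_by_def by (meson order_trans)

lemma not_ends_byE:
  assumes "\<not> ends_by u v"
  obtains e where "e \<in> I u" "\<forall>b\<in>I v. b < e"
  using assms unfolding ends_by_def by (meson not_less)

lemma ex_first: "\<lbrakk>A \<subseteq> pverts G; A \<noteq> {}\<rbrakk> \<Longrightarrow> \<exists>v\<in>A. \<forall>u\<in>A. ends_by v u"
  using finite_total_preorder_least[of A ends_by] pair_finite_verts
    ends_by_total ends_by_trans finite_subset by blast

lemma ex_last: "\<exists>t\<in>pverts G. \<forall>u\<in>pverts G. ends_by u t"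
  using finite_total_preorder_least[of "pverts G" "\<lambda>x y. ends_by y x"] pair_finite_verts
    verts_nonempty ends_by_total ends_by_trans by blast

section \<open>Radius one\<close>

text \<open>\<open>w\<close> touches \<open>v\<close>, which lies left of \<open>u\<close>, so
  \<open>w\<close> cannot lie wholly right of \<open>u\<close>. This keeps the robber on one side:
  no interval is passed without being met.\<close>

lemma before_arc:
  assumes "before v u" "(v, w) \<in> parcs G" "u \<in> pverts G" "u \<noteq> w" "(u, w) \<notin> parcs G"
  shows "before w u"
proof -
  have "w \<in> pverts G" using assms(2) in_arcsD2 by blast
  moreover have False if "before u w"
  proof -
    obtain a where "a \<in> I v" "a \<in> I w" using arc_meet[OF assms(2)] .
    moreover obtain b where "b \<in> I u" using nonempty[OF assms(3)] by blast
    ultimately have "a < b" "b < a" using assms(1) that by (auto simp: before_def)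
    then show False by simp
  qed
  ultimately show ?thesis
    using meet_cases[OF assms(3), of w] assms(4,5) by blast
qed

text \<open>Induction backwards along the walk: nothing lies right of \<open>t\<close>, and each
  earlier arc keeps every uncaught robber on the right of the cop.\<close>

lemma trap_sweep_1:
  assumes "v \<rightarrow>\<^sup>*\<^bsub>with_proj G\<^esub> t" "\<forall>u\<in>pverts G. ends_by u t"
  shows "trap G 1 v {u \<in> pverts G. before v u}"
  using assms(1)
proof (induction rule: converse_reachable_induct)
  case base
  have "{u \<in> pverts G. before t u} = {}"
    using assms(2) before_imp_not_ends_by by blast
  moreover have "t \<in> pverts G" using assms(1) reachable_in_verts by auto
  ultimately show ?case using trap_empty by metis
next
  case (step x y)
  then have xy: "(x, y) \<in> parcs G" by simp
  show ?case
  proof (rule trap_step[OF step.IH])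
    fix r r'
    assume r: "r \<in> {u \<in> pverts G. before x u}" and r': "r' \<in> pverts G"
      and rr': "r' = r \<or> (r, r') \<in> parcs G"
      and "\<not> graph_dist G y r \<le> ereal (real 1)" "\<not> graph_dist G y r' \<le> ereal (real 1)"
    then have far: "r \<noteq> y" "(r, y) \<notin> parcs G" "r' \<noteq> y" "(r', y) \<notin> parcs G"
      using graph_dist_self_le[OF in_arcsD2[OF xy]] graph_dist_arc_le arc_sym
      by (auto simp: one_ereal_def)
    have yr: "before y r" using before_arc[OF _ xy] r far by blast
    \<comment> \<open>The robber cannot jump over \<open>y\<close>: were \<open>r'\<close> on the
      left, \<open>before_arc\<close> along the reversed arc would put \<open>r\<close> on the left
      as well.\<close>
    have "before y r'" if "(r, r') \<in> parcs G"
    proof (rule ccontr)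
      assume "\<not> before y r'"
      then have "before r' y" using meet_cases[of r' y] r' far in_arcsD2[OF xy] by blast
      then have "before r y"
        using before_arc[of r' y r] arc_sym[OF that] far arc_sym in_arcsD2[OF xy] by blast
      then show False using yr nonempty[OF in_arcsD2[OF xy]] nonempty[of r] r
        unfolding before_def by fastforce
    qed
    then show "r' \<in> {u \<in> pverts G. before y u}" using yr r' rr' by blast
  qed (use xy in_arcsD1 in auto)
qed

lemma ex_winning_patrol_1: "\<exists>p. winning_patrol G 1 p"
proof -
  obtain v where v: "v \<in> pverts G" "\<forall>u\<in>pverts G. ends_by v u"
    using ex_first[of "pverts G"] verts_nonempty by blast
  obtain t where t: "t \<in> pverts G" "\<forall>u\<in>pverts G. ends_by u t"
    using ex_last by blast
  have "before v u" if "u \<in> pverts G" "\<not> graph_dist G v u \<le> ereal (real 1)" for u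
  proof (rule meet_cases[OF v(1) that(1)])
    assume "v = u"
    then show ?thesis using that graph_dist_self_le[OF v(1)] by (simp add: one_ereal_def)
  next
    assume "(v, u) \<in> parcs G"
    then show ?thesis using that graph_dist_arc_le by (auto simp: one_ereal_def)
  next
    assume "before u v"
    then show ?thesis using v that before_imp_not_ends_by by blast
  qed
  then show ?thesis
    using trap_sweep_1[OF all_reachable[OF v(1) t(1)] t(2)]
    by (intro trap_imp_winning_patrol[of _ _ v]) (auto elim: trap_mono)
qed

section \<open>Cycles and spines\<close>

text \<open>\<open>u\<close> starts out right of the walk and cannot be right of its last vertex,
  which ends last. By \<open>before_arc\<close> it leaves the right side only at a vertex equal or
  adjacent to it.\<close>

lemma path_dominates:
  assumes "vwalk p (with_proj G)" "before (hd p) u" "u \<in> pverts G" "\<forall>w\<in>pverts G. ends_by w (last p)"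
  shows "\<exists>w\<in>set p. u = w \<or> (u, w) \<in> parcs G"
  using assms
proof (induction p rule: vwalk_induct)
  case (Base v)
  then show ?case using before_imp_not_ends_by by auto
next
  case (Cons v w es)
  then have vw: "(v, w) \<in> parcs G" by simp
  show ?case
  proof (cases "u = w \<or> (u, w) \<in> parcs G")
    case False
    then have "before w u" using before_arc[OF _ vw] Cons.prems by auto
    then show ?thesis using Cons.IH Cons.prems by auto
  qed auto
qed

lemma reachable_imp_vwalk:
  assumes "u \<rightarrow>\<^sup>*\<^bsub>with_proj G\<^esub> v"
  shows "\<exists>p. vwalk p (with_proj G) \<and> hd p = u \<and> last p = v"
  using assms
proof (induction rule: converse_reachable_induct)
  case base
  then show ?case using assms reachable_in_verts by (intro exI[of _ "[v]"]) (auto simp: vwalk_def)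
next
  case (step x y)
  then obtain p where "vwalk p (with_proj G)" "hd p = y" "last p = v" by blast
  then show ?case using step in_arcsD1
    by (intro exI[of _ "x # p"]) (auto intro!: vwalk_consI elim: vwalkE)
qed

text \<open>Any path from a vertex ending first to one ending last will do, whether or not
  \<open>G\<close> has cycles. Hence failing to be a caterpillar means having a cycle.\<close>

lemma ex_spine: "\<exists>p. vpath p (with_proj G) \<and> (\<forall>v\<in>pverts G. \<exists>u\<in>set p. graph_dist G v u \<le> 1)"
proof -
  obtain v where v: "v \<in> pverts G" "\<forall>u\<in>pverts G. ends_by v u"
    using ex_first[of "pverts G"] verts_nonempty by blast
  obtain t where t: "t \<in> pverts G" "\<forall>u\<in>pverts G. ends_by u t"
    using ex_last by blast
  obtain p where p: "vpath p (with_proj G)" "hd p = v" "last p = t"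
    using reachable_imp_vwalk[OF all_reachable[OF v(1) t(1)]] vwalk_imp_ex_vpath by metis
  then have walk: "vwalk p (with_proj G)" and vp: "v \<in> set p" by (auto simp: vpath_def vwalk_def)
  have "\<exists>w\<in>set p. graph_dist G u w \<le> 1" if u: "u \<in> pverts G" for u
  proof -
    have "\<exists>w\<in>set p. u = w \<or> (u, w) \<in> parcs G"
      using meet_cases[OF u v(1)]
    proof cases
      case 3
      then show ?thesis using v u before_imp_not_ends_by by blast
    next
      case 4
      then show ?thesis using path_dominates[OF walk] p t u by auto
    qed (use vp in auto)
    then show ?thesis using graph_dist_self_le[OF u] graph_dist_arc_le by blast
  qed
  with p show ?thesis by blast
qed

lemma cycle_neighbours:
  assumes "undirected_cycle G c" "v \<in> set c"
  shows "\<exists>x\<in>set c. \<exists>y\<in>set c. x \<noteq> y \<and> (v, x) \<in> parcs G \<and> (v, y) \<in> parcs G"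
proof -
  obtain xs ys where c: "c = xs @ v # ys" using assms(2) by (meson split_list)
  have dist: "distinct c" and len: "3 \<le> length c" and wrap: "(last c, hd c) \<in> parcs G"
    and arcs: "set (vwalk_arcs c) \<subseteq> parcs G"
    using assms(1) by (auto simp: undirected_cycle_def vpath_def vwalk_def)
  \<comment> \<open>At an end of the list the missing cyclic neighbour is the opposite end, joined
    by the closing arc.\<close>
  let ?x = "if xs = [] then last c else last xs"
  let ?y = "if ys = [] then hd c else hd ys"
  have "(?x, v) \<in> parcs G"
  proof (cases "xs = []")
    case False
    then show ?thesis using arcs c vwalk_arcs_append[of xs "v # ys"] by simp
  qed (use wrap c in simp)
  moreover have "(v, ?y) \<in> parcs G"
  proof (cases "ys = []")
    case False
    then have "(v, hd ys) \<in> set (vwalk_arcs (v # ys))" by simp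
    then show ?thesis using arcs c set_vwalk_arcs_append2[of "v # ys" xs] False by auto
  qed (use wrap c in simp)
  moreover have "?x \<noteq> ?y"
  proof (cases "xs = [] \<or> ys = []")
    case True
    have "last zs \<noteq> hd zs" if zs: "distinct zs" "2 \<le> length zs" for zs :: "'a list"
    proof -
      obtain z z' zs' where "zs = z # z' # zs'"
        using zs(2) by (cases zs; cases "tl zs") auto
      then show ?thesis using zs(1) last_in_set[of "z' # zs'"] by auto
    qed
    from this[of xs] this[of ys] show ?thesis using True dist len c by auto
  next
    case False
    then have "last xs \<in> set xs" "hd ys \<in> set ys" by auto
    then have "last xs \<noteq> hd ys" using dist c by fastforce
    then show ?thesis using False by simp
  qed
  moreover have "?x \<in> set c" "?y \<in> set c" using c by (auto simp: hd_append)
  ultimately show ?thesis using arc_sym by blast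
qed

text \<open>
  The cycle vertex whose interval ends first has two cycle neighbours; both reach its right end,
  so these three intervals share a point.
\<close>

lemma cycle_imp_triangle:
  assumes "undirected_cycle G c"
  shows "\<exists>x y z. (x, y) \<in> parcs G \<and> (y, z) \<in> parcs G \<and> (z, x) \<in> parcs G"
proof -
  have "set c \<subseteq> pverts G" "set c \<noteq> {}"
    using assms by (auto simp: undirected_cycle_def vpath_def vwalk_def)
  then obtain v where v: "v \<in> set c" "\<forall>u\<in>set c. ends_by v u" using ex_first by blast
  obtain x y where xy: "x \<in> set c" "y \<in> set c" "x \<noteq> y" "(v, x) \<in> parcs G" "(v, y) \<in> parcs G"
    using cycle_neighbours[OF assms v(1)] by blast
  obtain a where a: "a \<in> I v" "a \<in> I x" using arc_meet[OF xy(4)] .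
  obtain b where b: "b \<in> I v" "b \<in> I y" using arc_meet[OF xy(5)] .
  have mem: "x \<in> pverts G" "y \<in> pverts G" using xy in_arcsD2 by auto
  have "I x \<inter> I y \<noteq> {}"
  proof (cases "a \<le> b")
    case True
    then have "b \<in> I x"
      using v(2) xy(1) a b in_between[OF mem(1)] unfolding ends_by_def by meson
    then show ?thesis using b by blast
  next
    case False
    then have "a \<in> I y"
      using v(2) xy(2) a b in_between[OF mem(2)] unfolding ends_by_def by (meson linear)
    then show ?thesis using a by blast
  qed
  then have "(x, y) \<in> parcs G" using arc_iff[OF mem xy(3)] by blast
  then show ?thesis using xy arc_sym by blast
qed

lemma not_caterpillar_imp_triangle:
  assumes "\<not> caterpillar G"
  shows "\<exists>x y z. (x, y) \<in> parcs G \<and> (y, z) \<in> parcs G \<and> (z, x) \<in> parcs G"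
proof -
  have "\<not> undirected_tree G" using assms ex_spine by (simp only: caterpillar_def simp_thms)
  then obtain c where "undirected_cycle G c"
    using conn by (simp only: undirected_tree_def simp_thms) (rule exE)
  then show ?thesis by (rule cycle_imp_triangle)
qed

end

section \<open>Radius zero\<close>

locale triangle_free_interval_graph = connected_interval_graph +
  assumes triangle_free: "\<lbrakk>(x, y) \<in> parcs G; (y, z) \<in> parcs G; (z, x) \<in> parcs G\<rbrakk> \<Longrightarrow> False"
begin

lemma no_common_point:
  assumes "u \<in> pverts G" "v \<in> pverts G" "w \<in> pverts G" "u \<noteq> v" "v \<noteq> w" "w \<noteq> u"
    and "a \<in> I u" "a \<in> I v" "a \<in> I w"
  shows False
proof (rule triangle_free)
  show "(u, v) \<in> parcs G" using arc_iff[OF assms(1,2,4)] assms(7,8) by blast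
  show "(v, w) \<in> parcs G" using arc_iff[OF assms(2,3,5)] assms(8,9) by blast
  show "(w, u) \<in> parcs G" using arc_iff[OF assms(3,1,6)] assms(9,7) by blast
qed

text \<open>Of a point shared by \<open>u\<close> and \<open>v\<close> and one shared by
  \<open>u\<close> and \<open>w\<close>, the larger lies in all three intervals, because
  \<open>u\<close> ends by \<open>v\<close> and \<open>w\<close> reaches beyond \<open>v\<close>.
  That gives a triangle.\<close>

lemma inner_neighbour_closed:
  assumes "(u, v) \<in> parcs G" "ends_by u v" "\<not> ends_by w v"
  shows "(u, w) \<notin> parcs G"
proof
  assume uw: "(u, w) \<in> parcs G"
  have mem: "u \<in> pverts G" "v \<in> pverts G" "w \<in> pverts G"
    using assms(1) uw in_arcsD1 in_arcsD2 by auto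
  have neq: "u \<noteq> v" "v \<noteq> w" "w \<noteq> u"
    using arc_neq[OF assms(1)] arc_neq[OF uw] assms(3) ends_by_refl by auto
  obtain a where a: "a \<in> I u" "a \<in> I v" using arc_meet[OF assms(1)] .
  obtain b where b: "b \<in> I u" "b \<in> I w" using arc_meet[OF uw] .
  obtain e where e: "e \<in> I w" "\<forall>b\<in>I v. b < e" using not_ends_byE[OF assms(3)] .
  show False
  proof (cases "a \<le> b")
    case True
    then have "b \<in> I v"
      using assms(2) a b in_between[OF mem(2)] unfolding ends_by_def by meson
    then show False using no_common_point[OF mem neq] b by blast
  next
    case False
    then have "a \<in> I w" using in_between[OF mem(3) b(2) e(1)] bspec[OF e(2) a(2)] by simp
    then show False using no_common_point[OF mem neq] a by blast
  qed
qed

text \<open>This is the cut vertex of the sweep: the robber passes between the intervals ending by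
  \<open>v\<close> and those reaching beyond it only through \<open>v\<close>.\<close>

definition gate :: "'a \<Rightarrow> bool" where
  "gate v \<longleftrightarrow> v \<in> pverts G \<and>
     (\<forall>u w. (u, w) \<in> parcs G \<and> ends_by u v \<and> \<not> ends_by w v \<longrightarrow> u = v)"

lemma gate_first:
  assumes "v \<in> pverts G" "\<forall>u\<in>pverts G. ends_by v u"
  shows "gate v"
  unfolding gate_def
proof (intro conjI allI impI)
  fix u w assume uw: "(u, w) \<in> parcs G \<and> ends_by u v \<and> \<not> ends_by w v"
  then have u: "u \<in> pverts G" using in_arcsD1 by blast
  show "u = v"
    using meet_cases[OF u assms(1)]
  proof cases
    case 2
    then show ?thesis using inner_neighbour_closed uw by blast
  next
    case 3
    then show ?thesis using before_imp_not_ends_by assms u by blast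
  next
    case 4
    then show ?thesis using before_imp_not_ends_by uw u by blast
  qed
qed (rule assms)

text \<open>If \<open>u\<close> meets \<open>v'\<close>, then \<open>inner_neighbour_closed\<close>
  applies. If \<open>u\<close> lies left of \<open>v'\<close>, then \<open>w\<close> stretches from
  \<open>u\<close> past \<open>v'\<close> and covers a common point of \<open>v\<close> and
  \<open>v'\<close>, giving a triangle.\<close>

lemma gate_next:
  assumes vv': "(v, v') \<in> parcs G" and beyond: "\<not> ends_by v' v"
  shows "gate v'"
  unfolding gate_def
proof (intro conjI allI impI)
  fix u w assume uw: "(u, w) \<in> parcs G \<and> ends_by u v' \<and> \<not> ends_by w v'"
  have mem: "u \<in> pverts G" "w \<in> pverts G" "v \<in> pverts G" "v' \<in> pverts G"
    using uw vv' in_arcsD1 in_arcsD2 by blast+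
  show "u = v'"
    using meet_cases[OF mem(1,4)]
  proof cases
    case 2
    then show ?thesis using inner_neighbour_closed uw by blast
  next
    case 3
    obtain b where b: "b \<in> I u" "b \<in> I w" using arc_meet uw by blast
    obtain c where c: "c \<in> I v" "c \<in> I v'" using arc_meet[OF vv'] .
    obtain e where e: "e \<in> I w" "\<forall>b\<in>I v'. b < e" using not_ends_byE uw by blast
    have "b < c" using 3 b c by (auto simp: before_def)
    then have "c \<in> I w" using in_between[OF mem(2) b(2) e(1)] bspec[OF e(2) c(2)] by simp
    moreover have "w \<noteq> v" "v' \<noteq> w" "v \<noteq> v'"
      using uw ends_by_total beyond ends_by_refl by blast+
    ultimately show ?thesis using no_common_point[of w v v'] mem c by blast
  next
    case 4
    then show ?thesis using before_imp_not_ends_by uw mem by blast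
  qed
qed (use vv' in_arcsD2 in blast)

text \<open>A walk from \<open>v\<close> to \<open>w\<close> crosses from the intervals ending by
  \<open>v\<close> to those reaching beyond it, and the gate condition makes the crossing arc start
  at \<open>v\<close>. By \<open>gate_next\<close> its head is again a gate.\<close>

lemma ex_next_gate:
  assumes v: "gate v" and w: "w \<in> pverts G" "\<not> ends_by w v"
  shows "\<exists>v'. (v, v') \<in> parcs G \<and> \<not> ends_by v' v"
proof -
  have "v \<rightarrow>\<^sup>*\<^bsub>with_proj G\<^esub> w" using v w all_reachable by (auto simp: gate_def)
  then have "ends_by w v \<or> (\<exists>a b. (a, b) \<in> parcs G \<and> ends_by a v \<and> \<not> ends_by b v)"
  proof (induction rule: reachable_induct)
    case base
    then show ?case using ends_by_refl by blast
  next
    case (step x y)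
    then show ?case by auto
  qed
  with v w show ?thesis unfolding gate_def by blast
qed

text \<open>
  No vertex of \<open>Y\<close> is adjacent to a vertex \<open>l \<in> Y\<close> ending by \<open>v\<close>, so the robber can enter \<open>l\<close>
  only from \<open>v\<close>. The excursions \<open>v, l, v\<close> of the cop hence clear these \<open>l\<close> one after the other.
\<close>

lemma trap_clear_gate:
  assumes v: "gate v" and Y: "Y \<subseteq> pverts G" "v \<notin> Y"
    and closed: "\<And>r r'. \<lbrakk>r \<in> Y; (r, r') \<in> parcs G\<rbrakk> \<Longrightarrow> r' = v \<or> r' \<in> Y"
    and adj: "\<And>r. \<lbrakk>r \<in> Y; ends_by r v\<rbrakk> \<Longrightarrow> (r, v) \<in> parcs G"
    and beyond: "trap G 0 v {r \<in> pverts G. \<not> ends_by r v}"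
  shows "trap G 0 v Y"
proof -
  \<comment> \<open>If \<open>r\<close> also ends by \<open>v\<close>, then \<open>r\<close>,
    \<open>l\<close>, \<open>v\<close> form a triangle; otherwise the gate condition forces
    \<open>l = v\<close>, which is not in \<open>Y\<close>.\<close>
  have isolated: False if "r \<in> Y" "l \<in> Y" "ends_by l v" "(r, l) \<in> parcs G" for r l
  proof (cases "ends_by r v")
    case True
    then show False using that adj triangle_free arc_sym by blast
  next
    case False
    then show False using that v arc_sym Y(2) unfolding gate_def by blast
  qed
  have "trap G 0 v ({r \<in> Y. \<not> ends_by r v} \<union> D)"
    if "finite D" "D \<subseteq> {r \<in> Y. ends_by r v}" for D
    using that
  proof (induction D rule: finite_induct)
    case empty
    then show ?case using Y beyond by (auto elim: trap_mono)
  next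
    case (insert l D)
    let ?S = "{r \<in> Y. \<not> ends_by r v} \<union> insert l D"
    have l: "l \<in> Y" "ends_by l v" "(l, v) \<in> parcs G" "l \<in> pverts G"
      using insert.prems adj Y by auto
    have SY: "?S \<subseteq> Y" using insert.prems by auto
    \<comment> \<open>While the cop is on \<open>l\<close> the robber may slip into
      \<open>v\<close>, where the cop's return catches him; no other possible position leads into
      \<open>l\<close>.\<close>
    have "trap G 0 l (insert v (?S - {l}))"
    proof (rule trap_step)
      show "trap G 0 v ({r \<in> Y. \<not> ends_by r v} \<union> D)" using insert by auto
    next
      fix r r'
      assume r: "r \<in> insert v (?S - {l})" "r' = r \<or> (r, r') \<in> parcs G"
        and "\<not> graph_dist G v r \<le> ereal (real 0)" "\<not> graph_dist G v r' \<le> ereal (real 0)"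
      then have "r \<noteq> v" "r' \<noteq> v"
        using graph_dist_le_0_iff v by (auto simp: gate_def zero_ereal_def[symmetric])
      with r have "r' = r \<or> r' \<in> Y \<and> \<not> ends_by r' v"
        using closed isolated SY by blast
      with r \<open>r \<noteq> v\<close> show "r' \<in> {r \<in> Y. \<not> ends_by r v} \<union> D" by blast
    qed (use l in auto)
    then show ?case
    proof (rule trap_step)
      fix r r'
      assume r: "r \<in> ?S" "r' = r \<or> (r, r') \<in> parcs G"
        and "\<not> graph_dist G l r \<le> ereal (real 0)" "\<not> graph_dist G l r' \<le> ereal (real 0)"
      then have "r \<noteq> l" "r' \<noteq> l"
        using graph_dist_le_0_iff l by (auto simp: zero_ereal_def[symmetric])
      with r show "r' \<in> insert v (?S - {l})"
        using closed isolated SY by blast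
    qed (use l v arc_sym in \<open>auto simp: gate_def\<close>)
  qed
  from this[of "{r \<in> Y. ends_by r v}"] show ?thesis
    using finite_subset[OF Y(1) pair_finite_verts] by (auto elim: trap_mono)
qed

text \<open>Induction on the number of vertices reaching beyond \<open>v\<close>. The cop steps to a
  next gate \<open>v'\<close> and clears the vertices ending by \<open>v'\<close>; fewer remain,
  because \<open>v'\<close> itself no longer counts.\<close>

lemma trap_sweep_0:
  assumes "gate v"
  shows "trap G 0 v {r \<in> pverts G. \<not> ends_by r v}"
  using assms
proof (induction "card {r \<in> pverts G. \<not> ends_by r v}" arbitrary: v rule: less_induct)
  case less
  have v: "v \<in> pverts G" using less.prems by (simp add: gate_def)
  show ?case
  proof (cases "{r \<in> pverts G. \<not> ends_by r v} = {}")
    case True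
    then show ?thesis using trap_empty v by metis
  next
    case False
    then obtain v' where vv': "(v, v') \<in> parcs G" and beyond: "\<not> ends_by v' v"
      using ex_next_gate[OF less.prems] by blast
    have v': "v' \<in> pverts G" "gate v'" using vv' beyond in_arcsD2 gate_next by auto
    have "{r \<in> pverts G. \<not> ends_by r v'} \<subset> {r \<in> pverts G. \<not> ends_by r v}"
      using beyond v' ends_by_trans ends_by_total ends_by_refl by blast
    then have rest: "trap G 0 v' {r \<in> pverts G. \<not> ends_by r v'}"
      using less.hyps v' pair_finite_verts by (simp add: psubset_card_mono)
    obtain c where c: "c \<in> I v" "c \<in> I v'" using arc_meet[OF vv'] .
    \<comment> \<open>By the gate condition the robber can only return into \<open>v\<close>. Both
      \<open>r\<close> and \<open>v'\<close> meet \<open>v\<close> and reach beyond it, so the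
      larger of \<open>a\<close> and \<open>c\<close> lies in all three intervals.\<close>
    have no_return: False
      if r: "\<not> ends_by r v" "r \<noteq> v'" and arc: "(r, r') \<in> parcs G" and r': "ends_by r' v" for r r'
    proof -
      have "r' = v" using less.prems arc r r' arc_sym unfolding gate_def by blast
      then have rv: "(r, v) \<in> parcs G" using arc by simp
      then have mem: "r \<in> pverts G" using in_arcsD1 by blast
      obtain a where a: "a \<in> I r" "a \<in> I v" using arc_meet[OF rv] .
      obtain e where e: "e \<in> I r" "\<forall>b\<in>I v. b < e" using not_ends_byE[OF r(1)] .
      obtain e' where e': "e' \<in> I v'" "\<forall>b\<in>I v. b < e'" using not_ends_byE[OF beyond] .
      have "c \<in> I r \<or> a \<in> I v'"
        using in_between[OF mem a(1) e(1), of c] bspec[OF e(2) c(1)]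
          in_between[OF v'(1) c(2) e'(1), of a] bspec[OF e'(2) a(2)] by linarith
      then show False
        using no_common_point[of r v v'] mem v v' a c r(2) arc_neq[OF rv] arc_neq[OF vv'] by blast
    qed
    let ?Y = "{r \<in> pverts G. \<not> ends_by r v} - {v'}"
    have "trap G 0 v' ?Y"
    proof (rule trap_clear_gate[OF v'(2) _ _ _ _ rest])
      fix r r' assume "r \<in> ?Y" "(r, r') \<in> parcs G"
      then show "r' = v' \<or> r' \<in> ?Y" using no_return in_arcsD2 by blast
    next
      fix r assume r: "r \<in> ?Y" "ends_by r v'"
      then have mem: "r \<in> pverts G" by blast
      obtain e where e: "e \<in> I r" "\<forall>b\<in>I v. b < e" using not_ends_byE r by blast
      \<comment> \<open>\<open>r\<close> reaches beyond \<open>v\<close>, hence past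
        \<open>c\<close>, so it is not left of \<open>v'\<close>; as it ends by \<open>v'\<close>,
        it is not right of it either.\<close>
      show "(r, v') \<in> parcs G"
        using meet_cases[OF mem v'(1)]
      proof cases
        case 3
        then have "e < c" using e c by (auto simp: before_def)
        then show ?thesis using bspec[OF e(2) c(1)] by simp
      next
        case 4
        then show ?thesis using before_imp_not_ends_by r mem by blast
      qed (use r in auto)
    qed auto
    then show ?thesis
    proof (rule trap_step)
      fix r r'
      assume r: "r \<in> {r \<in> pverts G. \<not> ends_by r v}" "r' \<in> pverts G" "r' = r \<or> (r, r') \<in> parcs G"
        and "\<not> graph_dist G v' r \<le> ereal (real 0)" "\<not> graph_dist G v' r' \<le> ereal (real 0)"
      then have "r \<noteq> v'" "r' \<noteq> v'"
        using graph_dist_le_0_iff v' by (auto simp: zero_ereal_def[symmetric])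
      with r show "r' \<in> ?Y" using no_return by blast
    qed (use v vv' in auto)
  qed
qed

text \<open>A vertex ending first is a gate, and every vertex tied with it is adjacent to it, so one
  clearing there leaves only what \<open>trap_sweep_0\<close> handles.\<close>

lemma ex_winning_patrol_0: "\<exists>p. winning_patrol G 0 p"
proof -
  obtain v where v: "v \<in> pverts G" "\<forall>u\<in>pverts G. ends_by v u"
    using ex_first[of "pverts G"] verts_nonempty by blast
  have gate: "gate v" using gate_first v by blast
  have "trap G 0 v (pverts G - {v})"
  proof (rule trap_clear_gate[OF gate _ _ _ _ trap_sweep_0[OF gate]])
    fix r assume r: "r \<in> pverts G - {v}" "ends_by r v"
    then show "(r, v) \<in> parcs G"
      using meet_cases[of r v] v before_imp_not_ends_by by blast
  qed (use in_arcsD2 in auto)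
  moreover have "{r \<in> pverts G. \<not> graph_dist G v r \<le> ereal (real 0)} \<subseteq> pverts G - {v}"
    using graph_dist_le_0_iff v by (auto simp: zero_ereal_def[symmetric])
  ultimately show ?thesis using trap_imp_winning_patrol trap_mono by metis
qed

end

theorem theorem9:
  fixes G :: "'a pair_pre_digraph"
  assumes "pair_graph G"
    and "Digraph_Component.connected (with_proj G)"
    and "interval_graph G"
  shows "(caterpillar G \<longrightarrow> patrol_radius G = 0) \<and> (\<not> caterpillar G \<longrightarrow> patrol_radius G = 1)"
proof -
  obtain I :: "'a \<Rightarrow> real set" where
    "\<forall>v\<in>pverts G. is_interval (I v) \<and> I v \<noteq> {}"
    "\<forall>u\<in>pverts G. \<forall>v\<in>pverts G. u \<noteq> v \<longrightarrow> ((u, v) \<in> parcs G \<longleftrightarrow> I u \<inter> I v \<noteq> {})"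
    using assms(3) by (auto simp: interval_graph_def)
  then interpret connected_interval_graph G I
    using assms(1,2) by (simp add: connected_interval_graph_def connected_interval_graph_axioms_def)
  show ?thesis
  proof (intro conjI impI)
    assume cat: "caterpillar G"
    interpret triangle_free_interval_graph G I
      using caterpillar_triangle_free[OF cat] by unfold_locales blast
    show "patrol_radius G = 0"
      unfolding patrol_radius_def using ex_winning_patrol_0 by (intro Least_equality) auto
  next
    assume "\<not> caterpillar G"
    then have "\<not> winning_patrol G 0 p" for p
      using not_caterpillar_imp_triangle no_winning_patrol_of_triangle by blast
    then have "1 \<le> k" if "\<exists>p. winning_patrol G k p" for k
      using that by (cases k) auto
    then show "patrol_radius G = 1"
      unfolding patrol_radius_def using ex_winning_patrol_1 by (intro Least_equality) auto
  qed
qed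

end
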